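(* Let $\alpha,\eta>0$ and let $(\mathbf x^r,\mathbf v^r)_{r\ge0}$ be generated by PDFP2O applied to $\min_{\mathbf x}\mathbf f(\mathbf x)+\mathbf g(\mathbf B^{1/2}\mathbf x)$, namely $$\mathbf v^{r+1}=\mathrm{prox}_{\frac{\alpha}{\eta}\mathbf g^*}\Big(\mathbf B^{1/2}(\mathbf x^r-\alpha\nabla\mathbf f(\mathbf x^r))+(\mathbf I-\eta\mathbf B)\mathbf v^r\Big),\qquad \mathbf x^{r+1}=\mathbf x^r-\alpha\nabla\mathbf f(\mathbf x^r)-\eta\mathbf B^{1/2}\mathbf v^{r+1}.$$ Then, with $\mathbf y^r=\mathbf B^{1/2}\mathbf v^r$, these updates can be rewritten as $$\mathbf\Phi^r=\mathbf x^r-\alpha\nabla\mathbf f(\mathbf x^r)-\eta\mathbf y^r,\qquad \mathbf y^{r+1}=\mathbf y^r+(\mathbf I-\mathbf W)\mathbf\Phi^r,\qquad \mathbf x^{r+1}=\big((1-\eta)\mathbf I+\eta\mathbf W\big)\mathbf\Phi^r .$$ Consequently, when $\eta=\beta=1$, PDFP2O in this form is equivalent to (i.e. is the same recursion as) LED with one local step, $$\mathbf\Phi^r=\mathbf x^r-\alpha\nabla\mathbf f(\mathbf x^r)-\beta\mathbf y^r,\qquad \mathbf x^{r+1}=\mathbf W\mathbf\Phi^r,\qquad \mathbf y^{r+1}=\mathbf y^r+(\mathbf I-\mathbf W)\mathbf\Phi^r .$$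
   Context: $W\in\mathbb R^{N\times N}$ is symmetric, doubly stochastic, primitive and positive definite; $\mathbf W=W\otimes I_m$; $\mathbf B=\mathbf I-\mathbf W$ (positive semidefinite) and $\mathbf B^{1/2}$ is its positive semidefinite square root. For differentiable $f_i:\mathbb R^m\to\mathbb R$ and $\mathbf x=(x_1,\dots,x_N)\in\mathbb R^{mN}$, $\mathbf f(\mathbf x)=\sum_{i=1}^N f_i(x_i)$ and $\nabla\mathbf f(\mathbf x)$ stacks $\nabla f_1(x_1),\dots,\nabla f_N(x_N)$. The function $\mathbf g$ on $\mathbb R^{mN}$ is the indicator of zero: $\mathbf g(\mathbf u)=0$ if $\mathbf u=0$ and $+\infty$ otherwise; $\mathbf g^*$ is its convex conjugate, and $\mathrm{prox}_{c\mathbf h}(\mathbf u)=\arg\min_{\mathbf w}\{c\,\mathbf h(\mathbf w)+\frac12\|\mathbf w-\mathbf u\|^2\}$. *)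

theory Defs
  imports "HOL-Analysis.Analysis"
begin

definition sym_matrix :: "real^'n^'n \<Rightarrow> bool" where
  "sym_matrix A \<longleftrightarrow> transpose A = A"

definition doubly_stochastic :: "real^'n^'n \<Rightarrow> bool" where
  "doubly_stochastic A \<longleftrightarrow>
     (\<forall>i j. 0 \<le> A $ i $ j) \<and> (\<forall>i. (\<Sum>j\<in>UNIV. A $ i $ j) = 1) \<and> (\<forall>j. (\<Sum>i\<in>UNIV. A $ i $ j) = 1)"

(* The library's "^" on vectors is componentwise, so the matrix power is the iterated "**". *)
definition matrix_power :: "real^'n^'n \<Rightarrow> nat \<Rightarrow> real^'n^'n" where
  "matrix_power A k = (((**) A) ^^ k) (mat 1)"

definition primitive_matrix :: "real^'n^'n \<Rightarrow> bool" where
  "primitive_matrix A \<longleftrightarrow>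
     (\<forall>i j. 0 \<le> A $ i $ j) \<and> (\<exists>k>0. \<forall>i j. 0 < matrix_power A k $ i $ j)"

definition pos_def_matrix :: "real^'n^'n \<Rightarrow> bool" where
  "pos_def_matrix A \<longleftrightarrow> sym_matrix A \<and> (\<forall>u. u \<noteq> 0 \<longrightarrow> 0 < u \<bullet> (A *v u))"

definition pos_semidef_matrix :: "real^'n^'n \<Rightarrow> bool" where
  "pos_semidef_matrix A \<longleftrightarrow> sym_matrix A \<and> (\<forall>u. 0 \<le> u \<bullet> (A *v u))"

definition psd_sqrt :: "real^'n^'n \<Rightarrow> real^'n^'n" where
  "psd_sqrt A = (THE S. pos_semidef_matrix S \<and> S ** S = A)"

(* R^(mN) is real^('n \<times> 'm) with N = CARD('n), m = CARD('m): the index (i, k) is the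
   k-th coordinate of the i-th block, matching the row/column order of the Kronecker product. *)
definition kronecker :: "real^'n::finite^'n \<Rightarrow> real^'m::finite^'m \<Rightarrow> real^('n \<times> 'm)^('n \<times> 'm)" where
  "kronecker A C = (\<chi> p q. A $ fst p $ fst q * C $ snd p $ snd q)"

definition block :: "real^('n::finite \<times> 'm::finite) \<Rightarrow> 'n \<Rightarrow> real^'m" where
  "block x i = (\<chi> k. x $ (i, k))"

definition bold :: "real^'n::finite^'n \<Rightarrow> real^('n \<times> 'm::finite)^('n \<times> 'm)" where
  "bold W = kronecker W (mat 1)"

definition bold_B :: "real^'n::finite^'n \<Rightarrow> real^('n \<times> 'm::finite)^('n \<times> 'm)" where
  "bold_B W = mat 1 - bold W"

definition grad :: "('a::real_inner \<Rightarrow> real) \<Rightarrow> 'a \<Rightarrow> 'a" where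
  "grad h z = (THE D. GDERIV h z :> D)"

definition sum_fun :: "('n::finite \<Rightarrow> real^'m::finite \<Rightarrow> real) \<Rightarrow> real^('n \<times> 'm) \<Rightarrow> real" where
  "sum_fun f x = (\<Sum>i\<in>UNIV. f i (block x i))"

definition stacked_grad :: "('n::finite \<Rightarrow> real^'m::finite \<Rightarrow> real) \<Rightarrow> real^('n \<times> 'm) \<Rightarrow> real^('n \<times> 'm)" where
  "stacked_grad f x = (\<chi> p. grad (f (fst p)) (block x (fst p)) $ snd p)"

lemma GDERIV_unique:
  assumes "GDERIV h z :> D" "GDERIV h z :> D'"
  shows "D = D'"
proof -
  have "(\<lambda>u. u \<bullet> D) = (\<lambda>u. u \<bullet> D')"
    using assms unfolding gderiv_def by (rule has_derivative_unique)
  then show ?thesis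
    by (metis inner_commute vector_eq_rdot)
qed

lemma GDERIV_grad:
  fixes h :: "'a::euclidean_space \<Rightarrow> real"
  assumes "h differentiable (at z)"
  shows "GDERIV h z :> grad h z"
proof -
  obtain L where L: "(h has_derivative L) (at z)"
    using assms by (auto simp: differentiable_def)
  then interpret L: bounded_linear L by (rule has_derivative_bounded_linear)
  have "L = (\<lambda>u. u \<bullet> (\<Sum>b\<in>Basis. L b *\<^sub>R b))"
  proof
    fix u
    have "L u = L (\<Sum>b\<in>Basis. (u \<bullet> b) *\<^sub>R b)"
      by (simp add: euclidean_representation)
    also have "\<dots> = (\<Sum>b\<in>Basis. (u \<bullet> b) * L b)"
      by (simp add: L.sum L.scaleR)
    finally show "L u = u \<bullet> (\<Sum>b\<in>Basis. L b *\<^sub>R b)"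
      by (simp add: inner_sum_right mult.commute)
  qed
  then have "GDERIV h z :> (\<Sum>b\<in>Basis. L b *\<^sub>R b)"
    using L unfolding gderiv_def by simp
  then show ?thesis
    unfolding grad_def by (metis (lifting) theI GDERIV_unique)
qed

lemma GDERIV_sum_fun:
  assumes "\<And>i z. f i differentiable (at z)"
  shows "GDERIV (sum_fun f) x :> stacked_grad f x"
proof -
  have lin: "bounded_linear (\<lambda>x. block x i)" for i
    unfolding linear_conv_bounded_linear [symmetric]
    by (rule linearI) (simp_all add: block_def vec_eq_iff)
  have d: "((\<lambda>x. f i (block x i)) has_derivative (\<lambda>u. block u i \<bullet> grad (f i) (block x i))) (at x)"
    for i
    using has_derivative_compose [OF bounded_linear_imp_has_derivative [OF lin]
        GDERIV_grad [OF assms, unfolded gderiv_def]] .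
  have "(\<Sum>i\<in>UNIV. block u i \<bullet> grad (f i) (block x i)) = u \<bullet> stacked_grad f x" for u
    by (simp add: inner_vec_def stacked_grad_def block_def sum.cartesian_product
        UNIV_Times_UNIV [symmetric] case_prod_beta del: UNIV_Times_UNIV)
  moreover have "(sum_fun f has_derivative
      (\<lambda>u. \<Sum>i\<in>UNIV. block u i \<bullet> grad (f i) (block x i))) (at x)"
    unfolding sum_fun_def by (rule has_derivative_sum) (rule d)
  ultimately show ?thesis
    unfolding gderiv_def by simp
qed

definition ind_zero :: "'a::zero \<Rightarrow> ereal" where
  "ind_zero u = (if u = 0 then 0 else \<infinity>)"

definition conjugate :: "('a::real_inner \<Rightarrow> ereal) \<Rightarrow> 'a \<Rightarrow> ereal" where
  "conjugate h u = (SUP w. ereal (u \<bullet> w) - h w)"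

definition prox :: "real \<Rightarrow> ('a::real_inner \<Rightarrow> ereal) \<Rightarrow> 'a \<Rightarrow> 'a" where
  "prox c h u = (ARG_MIN (\<lambda>w. ereal c * h w + ereal (1/2 * (norm (w - u))\<^sup>2)) w. True)"

definition pdfp2o ::
  "real^'n::finite^'n \<Rightarrow> ('n \<Rightarrow> real^'m::finite \<Rightarrow> real) \<Rightarrow> real \<Rightarrow> real \<Rightarrow>
   (nat \<Rightarrow> real^('n \<times> 'm)) \<Rightarrow> (nat \<Rightarrow> real^('n \<times> 'm)) \<Rightarrow> bool" where
  "pdfp2o W f \<alpha> \<eta> x v \<longleftrightarrow> (\<forall>r.
     v (Suc r) = prox (\<alpha> / \<eta>) (conjugate ind_zero)
        (psd_sqrt (bold_B W) *v (x r - \<alpha> *\<^sub>R stacked_grad f (x r))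
         + (mat 1 - \<eta> *\<^sub>R bold_B W) *v v r) \<and>
     x (Suc r) = x r - \<alpha> *\<^sub>R stacked_grad f (x r) - \<eta> *\<^sub>R (psd_sqrt (bold_B W) *v v (Suc r)))"

definition pdfp2o_rewritten ::
  "real^'n::finite^'n \<Rightarrow> ('n \<Rightarrow> real^'m::finite \<Rightarrow> real) \<Rightarrow> real \<Rightarrow> real \<Rightarrow> (nat \<Rightarrow> real^('n \<times> 'm)) \<Rightarrow>
   (nat \<Rightarrow> real^('n \<times> 'm)) \<Rightarrow> (nat \<Rightarrow> real^('n \<times> 'm)) \<Rightarrow> bool" where
  "pdfp2o_rewritten W f \<alpha> \<eta> \<Phi> x y \<longleftrightarrow> (\<forall>r.
     \<Phi> r = x r - \<alpha> *\<^sub>R stacked_grad f (x r) - \<eta> *\<^sub>R y r \<and>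
     y (Suc r) = y r + (mat 1 - bold W) *v \<Phi> r \<and>
     x (Suc r) = ((1 - \<eta>) *\<^sub>R mat 1 + \<eta> *\<^sub>R bold W) *v \<Phi> r)"

definition led_one_step ::
  "real^'n::finite^'n \<Rightarrow> ('n \<Rightarrow> real^'m::finite \<Rightarrow> real) \<Rightarrow> real \<Rightarrow> real \<Rightarrow> (nat \<Rightarrow> real^('n \<times> 'm)) \<Rightarrow>
   (nat \<Rightarrow> real^('n \<times> 'm)) \<Rightarrow> (nat \<Rightarrow> real^('n \<times> 'm)) \<Rightarrow> bool" where
  "led_one_step W f \<alpha> \<beta> \<Phi> x y \<longleftrightarrow> (\<forall>r.
     \<Phi> r = x r - \<alpha> *\<^sub>R stacked_grad f (x r) - \<beta> *\<^sub>R y r \<and>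
     x (Suc r) = bold W *v \<Phi> r \<and>
     y (Suc r) = y r + (mat 1 - bold W) *v \<Phi> r)"

end

theory Submission
  imports Defs
begin

text \<open>The conjugate of the indicator of zero vanishes identically, so its prox is the identity.
  Since \<open>x - \<alpha> \<nabla>f(x) = \<Phi> + \<eta> y\<close> and \<open>B\<^sup>1\<^sup>/\<^sup>2 y = B v\<close>, the dual update collapses to
  \<open>v + B\<^sup>1\<^sup>/\<^sup>2 \<Phi>\<close>; applying \<open>B\<^sup>1\<^sup>/\<^sup>2\<close> gives the recursion for \<open>y\<close>. What takes work is that
  \<open>B\<^sup>1\<^sup>/\<^sup>2\<close>, a definite description, denotes: existence and uniqueness of positive semidefinite
  square roots both come from an orthonormal eigenbasis.\<close>

section \<open>Spectral theorem on an invariant subspace\<close>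

text \<open>The quadratic form \<open>x \<bullet> f x\<close> attains its maximum on the compact
  unit sphere of \<open>V\<close>; a maximiser is an eigenvector, with the maximum as
  eigenvalue.\<close>

lemma self_adjoint_eigenvector:
  fixes f :: "'a::euclidean_space \<Rightarrow> 'a"
  assumes f: "linear f" and sa: "\<And>a b. f a \<bullet> b = a \<bullet> f b"
    and V: "subspace V" "f ` V \<subseteq> V" "V \<noteq> {0}"
  obtains e c where "e \<in> V" "norm e = 1" "f e = c *\<^sub>R e"
proof -
  interpret f: linear f by (fact f)
  obtain a where a: "a \<in> V" "a \<noteq> 0"
    using V(1,3) subspace_0 by blast
  have "a /\<^sub>R norm a \<in> V \<inter> sphere 0 1"
    using a V(1) by (simp add: subspace_scale)
  then have ne: "V \<inter> sphere 0 1 \<noteq> {}" by blast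
  have "compact (V \<inter> sphere 0 1)"
    using V(1) by (intro closed_Int_compact closed_subspace compact_sphere)
  moreover have "continuous_on (V \<inter> sphere 0 1) (\<lambda>x. x \<bullet> f x)"
    using f by (intro continuous_intros linear_continuous_on) (simp add: linear_conv_bounded_linear)
  ultimately have "\<exists>e\<in>V \<inter> sphere 0 1. \<forall>x\<in>V \<inter> sphere 0 1. x \<bullet> f x \<le> e \<bullet> f e"
    using ne by (intro continuous_attains_sup)
  then obtain e where e: "e \<in> V" "norm e = 1"
    and max: "\<And>x. x \<in> V \<Longrightarrow> norm x = 1 \<Longrightarrow> x \<bullet> f x \<le> e \<bullet> f e"
    by auto
  define c where "c = e \<bullet> f e"
  \<comment> \<open>By maximality \<open>g\<close> has a nonnegative quadratic form on
    \<open>V\<close>, and this form vanishes at \<open>e\<close>. A nonnegative form can vanish only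
    where \<open>g\<close> itself does.\<close>
  define g where "g x = c *\<^sub>R x - f x" for x
  have gV: "g x \<in> V" if "x \<in> V" for x
    using that V unfolding g_def by (auto intro!: subspace_diff subspace_scale)
  have g_nonneg: "0 \<le> x \<bullet> g x" if "x \<in> V" for x
  proof (cases "x = 0")
    case False
    have "(x /\<^sub>R norm x) \<bullet> f (x /\<^sub>R norm x) \<le> c"
      unfolding c_def using that V(1) False by (intro max) (auto simp: subspace_scale)
    then have "x \<bullet> f x \<le> c * (norm x * norm x)"
      using False by (simp add: f.scaleR field_simps)
    then show ?thesis
      by (simp add: g_def inner_diff_right dot_square_norm power2_eq_square)
  qed simp
  have ge: "e \<bullet> g e = 0"
    using e by (simp add: g_def inner_diff_right c_def dot_square_norm)
  have "g e = 0"
  proof (rule ccontr)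
    assume "g e \<noteq> 0"
    define k where "k = g e \<bullet> g e"
    define q where "q = g e \<bullet> g (g e)"
    have k: "k > 0" using \<open>g e \<noteq> 0\<close> by (simp add: k_def)
    have q: "q \<ge> 0" unfolding q_def using gV g_nonneg e(1) by blast
    have sym: "a \<bullet> g b = g a \<bullet> b" for a b
      by (simp add: g_def inner_diff_left inner_diff_right sa)
    \<comment> \<open>Moving from \<open>e\<close> against \<open>g e\<close> changes the form at
      first order by \<open>- 2 * k * t\<close>, so a small positive \<open>t\<close> would make it
      negative.\<close>
    have expand: "(e - t *\<^sub>R g e) \<bullet> g (e - t *\<^sub>R g e) = t * (t * q - 2 * k)" for t
    proof -
      have diff: "g (e - t *\<^sub>R g e) = g e - t *\<^sub>R g (g e)"
        by (simp add: g_def f.diff f.add f.scaleR algebra_simps)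
      show ?thesis
        unfolding diff
        using ge sym [of e "g e"]
        by (simp add: k_def q_def inner_diff_left inner_diff_right algebra_simps)
    qed
    have "e - t *\<^sub>R g e \<in> V" for t
      using e gV V(1) by (intro subspace_diff subspace_scale) auto
    then have "0 \<le> t * (t * q - 2 * k)" for t
      using g_nonneg expand by metis
    \<comment> \<open>The \<open>+ 1\<close> keeps the denominator positive when
      \<open>q = 0\<close>, and this \<open>t\<close> still gives
      \<open>t * q \<le> k < 2 * k\<close>.\<close>
    from this [of "k / (q + 1)"] have "0 \<le> k / (q + 1) * q - 2 * k"
      using k q by (simp add: zero_le_mult_iff zero_le_divide_iff)
    moreover have "k / (q + 1) * q \<le> k"
      using k q by (simp add: field_simps)
    ultimately show False using k by linarith
  qed
  then show ?thesis
    by (intro that [OF e, of c]) (simp add: g_def)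
qed

text \<open>Induction on dimension: split off one unit eigenvector and pass to its orthogonal
  complement in \<open>V\<close>. The statement allows any invariant subspace so that the hypothesis
  applies to that complement.\<close>

lemma self_adjoint_orthonormal_eigenbasis_on:
  fixes f :: "'a::euclidean_space \<Rightarrow> 'a"
  assumes f: "linear f" and sa: "\<And>a b. f a \<bullet> b = a \<bullet> f b"
    and "subspace V" "f ` V \<subseteq> V"
  shows "\<exists>E. finite E \<and> pairwise orthogonal E \<and> span E = V \<and> (\<forall>e\<in>E. norm e = 1 \<and> (\<exists>c. f e = c *\<^sub>R e))"
  using assms(3,4)
proof (induction "dim V" arbitrary: V rule: less_induct)
  case less
  show ?case
  proof (cases "V = {0}")
    case True
    then show ?thesis by (intro exI [of _ "{}"]) auto
  next
    case False
    obtain e c where e: "e \<in> V" "norm e = 1" "f e = c *\<^sub>R e"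
      using self_adjoint_eigenvector [OF f sa less.prems False] by blast
    define U where "U = {x \<in> V. orthogonal e x}"
    have U: "subspace U"
      using less.prems(1) unfolding U_def subspace_def by (auto simp: orthogonal_clauses)
    \<comment> \<open>Self-adjointness moves \<open>f\<close> onto \<open>e\<close>, where it only
      scales, so orthogonality to \<open>e\<close> survives.\<close>
    have fU: "f ` U \<subseteq> U"
      using less.prems(2) e(3) by (auto simp: U_def orthogonal_def sa [symmetric])
    have "e \<notin> U"
      using e(2) by (auto simp: U_def orthogonal_def)
    then have "U \<subset> V"
      using e(1) by (auto simp: U_def)
    then have "dim U < dim V"
      by (metis U dim_psubset less.prems(1) span_eq_iff)
    then obtain E where E: "finite E" "pairwise orthogonal E" "span E = U"
      "\<forall>e\<in>E. norm e = 1 \<and> (\<exists>c. f e = c *\<^sub>R e)"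
      using less.hyps [OF _ U fU] by blast
    have EU: "E \<subseteq> U" using E(3) span_superset by blast
    have "span (insert e E) = V"
    proof
      show "span (insert e E) \<subseteq> V"
        using EU e(1) less.prems(1) by (intro span_minimal) (auto simp: U_def)
      show "V \<subseteq> span (insert e E)"
      proof
        fix x assume x: "x \<in> V"
        have "x - (e \<bullet> x) *\<^sub>R e \<in> U"
          using x e less.prems(1)
          by (auto simp: U_def orthogonal_def inner_diff_right dot_square_norm
              intro!: subspace_diff subspace_scale)
        then show "x \<in> span (insert e E)"
          unfolding span_insert E(3) by blast
      qed
    qed
    moreover have "pairwise orthogonal (insert e E)"
      using E(2) EU by (auto simp: pairwise_insert U_def orthogonal_commute)
    ultimately show ?thesis
      using E e by (intro exI [of _ "insert e E"]) auto
  qed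
qed

lemma sym_matrix_inner:
  assumes "sym_matrix A"
  shows "(A *v a) \<bullet> b = a \<bullet> (A *v b)"
  using assms dot_lmul_matrix [of a A b] transpose_matrix_vector [of A a]
  by (simp add: sym_matrix_def)

lemma sym_matrix_orthonormal_eigenbasis:
  assumes "sym_matrix A"
  obtains E c where "finite E" "pairwise orthogonal E" "span E = UNIV"
    "\<And>e. e \<in> E \<Longrightarrow> norm e = 1" "\<And>e. e \<in> E \<Longrightarrow> A *v e = c e *\<^sub>R e"
proof -
  obtain E where "finite E" "pairwise orthogonal E" "span E = UNIV"
    "\<forall>e\<in>E. norm e = 1 \<and> (\<exists>c. A *v e = c *\<^sub>R e)"
    using self_adjoint_orthonormal_eigenbasis_on [of "(*v) A" UNIV] sym_matrix_inner [OF assms]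
    by auto
  then show ?thesis using that by metis
qed

lemma matrix_eq_on_span:
  fixes A B :: "real^'n^'m"
  assumes "span E = UNIV" "\<And>e. e \<in> E \<Longrightarrow> A *v e = B *v e"
  shows "A = B"
proof -
  have "A *v x = B *v x" for x
    using assms by (intro linear_eq_on [of "(*v) A" "(*v) B" x E]) auto
  then show ?thesis by (simp add: matrix_eq)
qed

section \<open>Positive semidefinite square roots\<close>

text \<open>On an eigenvector \<open>e\<close> of \<open>S\<close> with eigenvalue \<open>s\<close>,
  equal squares give \<open>(T + s) (T - s) e = 0\<close>. For \<open>s > 0\<close> the factor
  \<open>T + s\<close> is injective, hence \<open>T e = s e\<close>.\<close>

lemma psd_sqrt_unique:
  fixes S T :: "real^'n^'n"
  assumes S: "pos_semidef_matrix S" and T: "pos_semidef_matrix T" and eq: "S ** S = T ** T"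
  shows "S = T"
proof -
  have symS: "sym_matrix S" and symT: "sym_matrix T"
    using S T by (auto simp: pos_semidef_matrix_def)
  obtain E s where E: "span E = UNIV" "\<And>e. e \<in> E \<Longrightarrow> norm e = 1" "\<And>e. e \<in> E \<Longrightarrow> S *v e = s e *\<^sub>R e"
    using sym_matrix_orthonormal_eigenbasis [OF symS] by metis
  have "S *v e = T *v e" if "e \<in> E" for e
  proof -
    have "0 \<le> e \<bullet> (S *v e)"
      using S by (simp add: pos_semidef_matrix_def)
    then have s: "0 \<le> s e"
      using E that by (simp add: dot_square_norm)
    have TT: "T *v (T *v e) = (s e * s e) *\<^sub>R e"
      by (metis E(3) eq matrix_vector_mul_assoc matrix_vector_mult_scaleR scaleR_scaleR that)
    define d where "d = T *v e - s e *\<^sub>R e"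
    have Td: "T *v d = - s e *\<^sub>R d"
      by (simp add: d_def matrix_vector_mult_diff_distrib matrix_vector_mult_scaleR TT algebra_simps)
    have "d = 0"
    proof (cases "s e = 0")
      \<comment> \<open>Here \<open>T + s\<close> may fail to be injective, but \<open>T e\<close>
        has squared norm \<open>e \<bullet> T (T e) = 0\<close>.\<close>
      case True
      then have "(T *v e) \<bullet> (T *v e) = 0"
        using TT by (simp add: sym_matrix_inner [OF symT])
      then show ?thesis using True by (simp add: d_def)
    next
      case False
      have "0 \<le> d \<bullet> (T *v d)"
        using T by (simp add: pos_semidef_matrix_def)
      then have "s e * (d \<bullet> d) \<le> 0"
        by (simp add: Td)
      then have "d \<bullet> d \<le> 0"
        using s False by (simp add: mult_le_0_iff)
      then show ?thesis
        by (metis inner_eq_zero_iff inner_ge_zero order_antisym)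
    qed
    then show ?thesis
      using E that by (simp add: d_def)
  qed
  then show ?thesis
    using matrix_eq_on_span E(1) by blast
qed

text \<open>Keep the eigenbasis of \<open>A\<close> and replace each eigenvalue, nonnegative by
  semidefiniteness, by its square root.\<close>

lemma psd_sqrt_exists:
  fixes A :: "real^'n^'n"
  assumes A: "pos_semidef_matrix A"
  shows "\<exists>S. pos_semidef_matrix S \<and> S ** S = A"
proof -
  obtain E c where E: "finite E" "pairwise orthogonal E" "span E = UNIV"
    "\<And>e. e \<in> E \<Longrightarrow> norm e = 1" "\<And>e. e \<in> E \<Longrightarrow> A *v e = c e *\<^sub>R e"
    using sym_matrix_orthonormal_eigenbasis A unfolding pos_semidef_matrix_def by metis
  have c: "0 \<le> c e" if "e \<in> E" for e
  proof -
    have "0 \<le> e \<bullet> (A *v e)"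
      using A by (simp add: pos_semidef_matrix_def)
    then show ?thesis using E that by (simp add: dot_square_norm)
  qed
  define h where "h x = (\<Sum>e\<in>E. (sqrt (c e) * (e \<bullet> x)) *\<^sub>R e)" for x
  define S where "S = matrix h"
  have "linear h"
    unfolding h_def
    by (rule linearI) (simp_all add: inner_add_right algebra_simps sum.distrib scaleR_sum_right)
  then have Sh: "S *v x = h x" for x
    by (simp add: S_def matrix_works)
  have inner_h: "y \<bullet> h x = (\<Sum>e\<in>E. sqrt (c e) * (e \<bullet> x) * (e \<bullet> y))" for x y
    by (simp add: h_def inner_sum_right inner_commute)
  \<comment> \<open>The expansion \<open>inner_h\<close> is symmetric in \<open>x\<close> and
    \<open>y\<close>.\<close>
  have "(transpose S *v x) \<bullet> y = (S *v x) \<bullet> y" for x y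
    by (simp add: transpose_matrix_vector dot_lmul_matrix inner_commute [of "h x"] Sh inner_h mult_ac)
  then have "transpose S *v x = S *v x" for x
    using vector_eq_rdot [of "transpose S *v x" "S *v x"] by blast
  then have "sym_matrix S"
    by (simp add: sym_matrix_def matrix_eq)
  moreover have "0 \<le> x \<bullet> (S *v x)" for x
    unfolding Sh inner_h using c by (intro sum_nonneg) (simp add: mult.assoc)
  moreover have "S ** S = A"
  proof (rule matrix_eq_on_span [OF E(3)])
    fix e assume e: "e \<in> E"
    have "(sqrt (c d) * (d \<bullet> e)) *\<^sub>R d = (if d = e then sqrt (c e) *\<^sub>R e else 0)" if "d \<in> E" for d
      using E(2) e that E(4) [OF e]
      by (auto simp: pairwise_def orthogonal_def dot_square_norm)
    then have "S *v e = sqrt (c e) *\<^sub>R e"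
      using E(1) e by (simp add: Sh h_def cong: sum.cong)
    then show "(S ** S) *v e = A *v e"
      using c [OF e] E(5) [OF e]
      by (simp add: matrix_vector_mul_assoc [symmetric] matrix_vector_mult_scaleR)
  qed
  ultimately show ?thesis
    unfolding pos_semidef_matrix_def by blast
qed

lemma psd_sqrt_square:
  assumes "pos_semidef_matrix A"
  shows "psd_sqrt A ** psd_sqrt A = A"
proof -
  have "\<exists>!S. pos_semidef_matrix S \<and> S ** S = A"
    using psd_sqrt_exists [OF assms] psd_sqrt_unique by metis
  from theI' [OF this] show ?thesis
    unfolding psd_sqrt_def by blast
qed

section \<open>Positive semidefiniteness of \<open>bold_B W\<close>\<close>

lemma sym_matrix_mat_1_diff:
  assumes "sym_matrix M"
  shows "sym_matrix (mat 1 - M)"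
  using assms by (simp add: sym_matrix_def transpose_def mat_def vec_eq_iff)

text \<open>Bound each product \<open>u $ p * u $ q\<close> by the mean of the two squares, weighted
  by the nonnegative entries of \<open>M\<close>; unit row and column sums then each contribute half
  of \<open>u \<bullet> u\<close>.\<close>

lemma pos_semidef_mat_1_diff:
  fixes M :: "real^'k^'k"
  assumes sym: "sym_matrix M" and ds: "doubly_stochastic M"
  shows "pos_semidef_matrix (mat 1 - M)"
proof -
  have "u \<bullet> (M *v u) \<le> u \<bullet> u" for u :: "real^'k"
  proof -
    have "u \<bullet> (M *v u) = (\<Sum>p\<in>UNIV. \<Sum>q\<in>UNIV. M $ p $ q * (u $ p * u $ q))"
      by (simp add: inner_vec_def matrix_vector_mult_def sum_distrib_left mult_ac)
    also have "\<dots> \<le> (\<Sum>p\<in>UNIV. \<Sum>q\<in>UNIV. M $ p $ q * ((u $ p)\<^sup>2 / 2 + (u $ q)\<^sup>2 / 2))"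
    proof (intro sum_mono mult_left_mono)
      fix p q
      show "u $ p * u $ q \<le> (u $ p)\<^sup>2 / 2 + (u $ q)\<^sup>2 / 2"
        using sum_squares_bound [of "u $ p" "u $ q"] by simp
      show "0 \<le> M $ p $ q"
        using ds by (simp add: doubly_stochastic_def)
    qed
    \<comment> \<open>The second half needs the summations exchanged before column sums
      appear.\<close>
    also have "\<dots> = (\<Sum>p\<in>UNIV. (\<Sum>q\<in>UNIV. M $ p $ q) * ((u $ p)\<^sup>2 / 2))
        + (\<Sum>q\<in>UNIV. (\<Sum>p\<in>UNIV. M $ p $ q) * ((u $ q)\<^sup>2 / 2))"
      using sum.swap [of "\<lambda>p q. M $ p $ q * ((u $ q)\<^sup>2 / 2)" UNIV UNIV]
      by (simp add: distrib_left sum.distrib sum_distrib_right sum_divide_distrib)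
    also have "\<dots> = u \<bullet> u"
      using ds by (simp add: doubly_stochastic_def inner_vec_def power2_eq_square
          flip: sum.distrib)
    finally show ?thesis .
  qed
  then show ?thesis
    using sym_matrix_mat_1_diff [OF sym]
    by (simp add: pos_semidef_matrix_def matrix_vector_mult_diff_rdistrib inner_diff_right)
qed

lemma sym_matrix_bold:
  assumes "sym_matrix W"
  shows "sym_matrix (bold W)"
proof -
  have "W $ i $ j = W $ j $ i" for i j
    using assms unfolding sym_matrix_def transpose_def by (metis vec_lambda_beta)
  then show ?thesis
    by (auto simp: sym_matrix_def bold_def kronecker_def transpose_def mat_def vec_eq_iff)
qed

text \<open>Row and column sums of a Kronecker product with the identity have this shape.\<close>

lemma sum_UNIV_prod_snd_delta:
  fixes a :: "'n::finite \<Rightarrow> real" and k :: "'m::finite"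
  shows "(\<Sum>q\<in>UNIV. a (fst q) * (if snd q = k then 1 else 0)) = (\<Sum>j\<in>UNIV. a j)"
proof -
  have "(\<Sum>q\<in>UNIV. a (fst q) * (if snd q = k then 1 else 0))
      = (\<Sum>j\<in>UNIV. \<Sum>l\<in>UNIV. a j * (if l = k then 1 else 0))"
    by (simp only: sum.cartesian_product UNIV_Times_UNIV case_prod_unfold)
  then show ?thesis by (simp add: sum_distrib_left [symmetric])
qed

lemma doubly_stochastic_bold:
  fixes W :: "real^'n::finite^'n"
  assumes "doubly_stochastic W"
  shows "doubly_stochastic (bold W :: real^('n \<times> 'm::finite)^('n \<times> 'm))"
proof -
  define M :: "real^('n \<times> 'm)^('n \<times> 'm)" where "M = bold W"
  have "(\<Sum>q\<in>UNIV. M $ (i, k) $ q) = (\<Sum>j\<in>UNIV. W $ i $ j)" for i k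
    \<comment> \<open>Along a row, the identity factor tests \<open>k = snd q\<close>, the reverse
      of the orientation in the delta sum.\<close>
    using sum_UNIV_prod_snd_delta [of "\<lambda>j. W $ i $ j" k, unfolded eq_commute [of _ k]]
    by (simp add: M_def bold_def kronecker_def mat_def)
  moreover have "(\<Sum>p\<in>UNIV. M $ p $ (j, k)) = (\<Sum>i\<in>UNIV. W $ i $ j)" for j k
    using sum_UNIV_prod_snd_delta [of "\<lambda>i. W $ i $ j" k]
    by (simp add: M_def bold_def kronecker_def mat_def)
  moreover have "0 \<le> M $ p $ q" for p q
    using assms by (simp add: doubly_stochastic_def M_def bold_def kronecker_def mat_def)
  ultimately show ?thesis
    using assms by (simp add: doubly_stochastic_def split_paired_all flip: M_def)
qed

section \<open>The proximal step\<close>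

text \<open>Every \<open>w\<close> other than zero contributes minus infinity to the supremum, and
  \<open>w = 0\<close> contributes 0.\<close>

lemma conjugate_ind_zero: "conjugate ind_zero = (\<lambda>u. 0)"
proof
  fix u :: 'a
  show "conjugate ind_zero u = 0"
    unfolding conjugate_def
  proof (rule antisym)
    show "(SUP w. ereal (u \<bullet> w) - ind_zero w) \<le> 0"
      by (rule SUP_least) (auto simp: ind_zero_def)
    show "0 \<le> (SUP w. ereal (u \<bullet> w) - ind_zero w)"
      by (rule SUP_upper2 [of 0]) (auto simp: ind_zero_def)
  qed
qed

text \<open>Only half the squared distance to \<open>u\<close> remains. Since \<open>prox\<close>
  chooses some minimiser, uniqueness of the minimiser is what determines its value.\<close>

lemma prox_zero: "prox c (\<lambda>u. 0) u = u"
  unfolding prox_def arg_min_def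
proof (rule some_equality)
  show "is_arg_min (\<lambda>w. ereal c * 0 + ereal (1/2 * (norm (w - u))\<^sup>2)) (\<lambda>w. True) u"
    by (simp add: is_arg_min_linorder)
next
  fix w assume "is_arg_min (\<lambda>w. ereal c * 0 + ereal (1/2 * (norm (w - u))\<^sup>2)) (\<lambda>w. True) w"
  then have "ereal c * 0 + ereal (1/2 * (norm (w - u))\<^sup>2) \<le> ereal c * 0 + ereal (1/2 * (norm (u - u))\<^sup>2)"
    unfolding is_arg_min_linorder by blast
  then show "w = u" by simp
qed

section \<open>Rewriting the recursion\<close>

text \<open>Taking the square root identity as a hypothesis separates the algebra of the updates
  from the spectral argument.\<close>

lemma pdfp2o_imp_rewritten:
  fixes f :: "'n::finite \<Rightarrow> real^'m::finite \<Rightarrow> real"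
  assumes B: "psd_sqrt (bold_B W) ** psd_sqrt (bold_B W) = (bold_B W :: real^('n \<times> 'm)^('n \<times> 'm))"
    and step: "pdfp2o W f \<alpha> \<eta> x v"
    and y: "\<And>r. y r = psd_sqrt (bold_B W) *v v r"
    and Phi: "\<And>r. \<Phi> r = x r - \<alpha> *\<^sub>R stacked_grad f (x r) - \<eta> *\<^sub>R y r"
  shows "pdfp2o_rewritten W f \<alpha> \<eta> \<Phi> x y"
proof -
  define R :: "real^('n \<times> 'm)^('n \<times> 'm)" where "R = psd_sqrt (bold_B W)"
  have RR: "R *v (R *v z) = bold_B W *v z" for z
    using B by (simp add: R_def matrix_vector_mul_assoc)
  have yR: "y r = R *v v r" for r
    using y by (simp add: R_def)
  have x_Phi: "x r - \<alpha> *\<^sub>R stacked_grad f (x r) = \<Phi> r + \<eta> *\<^sub>R y r" for r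
    by (simp add: Phi)
  have v: "v (Suc r) = v r + R *v \<Phi> r" for r
  proof -
    have "v (Suc r) = R *v (\<Phi> r + \<eta> *\<^sub>R y r) + (mat 1 - \<eta> *\<^sub>R bold_B W) *v v r"
      using step by (simp add: pdfp2o_def R_def conjugate_ind_zero prox_zero x_Phi)
    then show ?thesis
      by (simp add: matrix_vector_right_distrib matrix_vector_mult_scaleR yR RR
          matrix_vector_mult_diff_rdistrib scaleR_matrix_vector_assoc [symmetric])
  qed
  have y_Suc: "y (Suc r) = y r + bold_B W *v \<Phi> r" for r
    by (simp add: yR v matrix_vector_right_distrib RR)
  \<comment> \<open>Substituting the \<open>y\<close> update leaves \<open>\<Phi> r\<close> minus
    \<open>\<eta>\<close> times \<open>bold_B W *v \<Phi> r\<close>, and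
    \<open>I - \<eta> B = (1 - \<eta>) I + \<eta> W\<close>.\<close>
  have "x (Suc r) = ((1 - \<eta>) *\<^sub>R mat 1 + \<eta> *\<^sub>R bold W) *v \<Phi> r" for r
  proof -
    have "x (Suc r) = \<Phi> r + \<eta> *\<^sub>R y r - \<eta> *\<^sub>R y (Suc r)"
      using step by (simp add: pdfp2o_def y x_Phi)
    then show ?thesis
      by (simp add: y_Suc bold_B_def matrix_vector_mult_diff_rdistrib
          matrix_vector_mult_add_rdistrib scaleR_matrix_vector_assoc [symmetric] algebra_simps)
  qed
  then show ?thesis
    using y_Suc Phi by (simp add: pdfp2o_rewritten_def bold_B_def)
qed

text \<open>At \<open>\<eta> = 1\<close> the mixing matrix collapses to \<open>bold W\<close>; the
  remaining difference is the order of the conjuncts.\<close>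

lemma pdfp2o_rewritten_iff_led_one_step:
  "pdfp2o_rewritten W f \<alpha> 1 \<Phi> x y \<longleftrightarrow> led_one_step W f \<alpha> 1 \<Phi> x y"
  by (simp add: pdfp2o_rewritten_def led_one_step_def conj_ac)

text \<open>Being the same recursion is expressed by an equivalence over all triples of sequences,
  in addition to the claim about the given trajectory.\<close>

theorem proposition1:
  fixes W :: "real^'n::finite^'n"
    and f :: "'n \<Rightarrow> real^'m::finite \<Rightarrow> real"
    and \<alpha> \<eta> \<beta> :: real
    and x v y \<Phi> :: "nat \<Rightarrow> real^('n \<times> 'm)"
  assumes "sym_matrix W" "doubly_stochastic W" "primitive_matrix W" "pos_def_matrix W"
    and "\<And>i z. f i differentiable (at z)"
    and "\<alpha> > 0" "\<eta> > 0"
    and "pdfp2o W f \<alpha> \<eta> x v"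
    and "\<And>r. y r = psd_sqrt (bold_B W) *v v r"
    and "\<And>r. \<Phi> r = x r - \<alpha> *\<^sub>R stacked_grad f (x r) - \<eta> *\<^sub>R y r"
  shows "pdfp2o_rewritten W f \<alpha> \<eta> \<Phi> x y \<and>
         (\<eta> = 1 \<and> \<beta> = 1 \<longrightarrow>
           led_one_step W f \<alpha> \<beta> \<Phi> x y \<and>
           (\<forall>\<Phi>' x' y'. pdfp2o_rewritten W f \<alpha> \<eta> \<Phi>' x' y' \<longleftrightarrow> led_one_step W f \<alpha> \<beta> \<Phi>' x' y'))"
proof -
  have "pos_semidef_matrix (bold_B W :: real^('n \<times> 'm)^('n \<times> 'm))"
    unfolding bold_B_def
    by (intro pos_semidef_mat_1_diff sym_matrix_bold doubly_stochastic_bold assms)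
  then have "pdfp2o_rewritten W f \<alpha> \<eta> \<Phi> x y"
    using pdfp2o_imp_rewritten psd_sqrt_square assms(8-10) by blast
  then show ?thesis
    using pdfp2o_rewritten_iff_led_one_step by blast
qed

end
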